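(* Let $r\ge 2$. The Hamming code $H_r$ is the smallest linear code in cardinality which integrates all eigenspaces of $Q_{2^r-1}$ except for the eigenspace $\Lambda_{2^{r-1}}$.
   Context: $Q_d$ is the graph with vertex set $\{0,1\}^d$ in which two vertices are adjacent iff they differ in exactly one coordinate. A nonempty subset $W$ of the vertex set $V$ of a graph integrates $\phi:V\to\mathbb{R}$ if $\frac{1}{|W|}\sum_{w\in W}\phi(w)=\frac{1}{|V|}\sum_{v\in V}\phi(v)$, and integrates an eigenspace of the Laplacian $L=AD^{-1}-I$ ($A$ the adjacency matrix, $D$ the diagonal degree matrix, $I$ the identity matrix) if it integrates every eigenvector in a basis of that eigenspace. The eigenspaces of $L$ for $Q_d$ are $\Lambda_i=\operatorname{span}\{\phi_v: v\in\{0,1\}^d \text{ has exactly } i \text{ ones}\}$, $i=0,\dots,d$, where $\phi_v(x)=(-1)^{v^Tx}$. A linear code in $\{0,1\}^d$ is a linear subspace of $\{0,1\}^d$, viewed as a vector space with addition mod 2; here $d=2^r-1$. The Hamming code $H_r$ is $\{x\in\{0,1\}^{2^r-1}: M_rx=0 \text{ mod } 2\}$, where $M_r$ is the $r\times(2^r-1)$ matrix whose columns are the nonzero vectors of $\{0,1\}^r$, in a fixed order. *)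

theory Defs
  imports "HOL-Analysis.Analysis" "HOL-Library.Z2"
begin

instance bit :: finite
proof
  have "(UNIV :: bit set) = {0, 1}"
    using bit.exhaust by blast
  moreover have "finite {0, 1 :: bit}"
    by blast
  ultimately show "finite (UNIV :: bit set)"
    by metis
qed

section \<open>Finite graphs and their Laplacian\<close>

text \<open>
  A graph is given by its adjacency relation on a finite type of vertices.  A function
  \<open>\<phi>\<close> from the vertices \<open>'v\<close> to the reals is a vector in \<open>real ^ 'v\<close>.
\<close>

type_synonym 'v graph = "'v \<Rightarrow> 'v \<Rightarrow> bool"

definition adjacency_matrix :: "'v::finite graph \<Rightarrow> real ^ 'v ^ 'v" where
  "adjacency_matrix G = (\<chi> x y. of_bool (G x y))"

definition degree_matrix :: "'v::finite graph \<Rightarrow> real ^ 'v ^ 'v" where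
  "degree_matrix G = (\<chi> x y. if x = y then real (card {z. G x z}) else 0)"

definition laplacian :: "'v::finite graph \<Rightarrow> real ^ 'v ^ 'v" where
  "laplacian G = adjacency_matrix G ** matrix_inv (degree_matrix G) - mat 1"

definition laplacian_eigenspace :: "'v::finite graph \<Rightarrow> (real ^ 'v) set \<Rightarrow> bool" where
  "laplacian_eigenspace G E \<longleftrightarrow>
     E \<noteq> {0} \<and> (\<exists>\<mu>. E = {\<phi>. laplacian G *v \<phi> = \<mu> *s \<phi>})"

section \<open>Integration by vertex subsets\<close>

definition integrates :: "'v::finite set \<Rightarrow> real ^ 'v \<Rightarrow> bool" where
  "integrates W \<phi> \<longleftrightarrow>
     W \<noteq> {} \<and> (\<Sum>w\<in>W. \<phi> $ w) / real (card W) = (\<Sum>v\<in>UNIV. \<phi> $ v) / real CARD('v)"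

definition integrates_eigenspace :: "'v::finite set \<Rightarrow> (real ^ 'v) set \<Rightarrow> bool" where
  "integrates_eigenspace W E \<longleftrightarrow>
     (\<exists>B \<subseteq> E. independent B \<and> span B = E \<and> (\<forall>\<phi>\<in>B. integrates W \<phi>))"

section \<open>The cube graph\<close>

definition cube :: "(bit ^ 'd::finite) graph" where
  "cube x y \<longleftrightarrow> card {i. x $ i \<noteq> y $ i} = 1"

text \<open>The cardinality in the exponent is the integer \<open>v\<^sup>T x\<close>.\<close>

definition cube_character :: "bit ^ 'd::finite \<Rightarrow> real ^ (bit ^ 'd)" where
  "cube_character v = (\<chi> x. (-1) ^ card {i. v $ i = 1 \<and> x $ i = 1})"

definition cube_Lambda :: "nat \<Rightarrow> (real ^ (bit ^ 'd::finite)) set" where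
  "cube_Lambda k = span {cube_character v | v. card {i. v $ i = 1} = k}"

section \<open>Hamming codes\<close>

text \<open>
  The columns of the parity-check matrix are the nonzero vectors, each occurring exactly once.
  The order of the columns is the choice of the bijection from the coordinates \<open>'d\<close>.
\<close>

definition hamming_matrix :: "bit ^ 'd::finite ^ 'r::finite \<Rightarrow> bool" where
  "hamming_matrix M \<longleftrightarrow> bij_betw (\<lambda>j. column j M) UNIV {u. u \<noteq> 0}"

definition hamming_code :: "bit ^ 'd::finite ^ 'r::finite \<Rightarrow> (bit ^ 'd) set" where
  "hamming_code M = {x. M *v x = 0}"

end

theory Submission
  imports Defs
begin

text \<open>
  Write \<open>n = 2\<^sup>r - 1\<close> for the length and \<open>\<chi>\<^sub>v\<close> for the character of \<open>v\<close>.  The characters form an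
  orthogonal basis of the functions on the cube, and \<open>\<chi>\<^sub>v\<close> is an eigenvector of the Laplacian whose
  eigenvalue determines the weight of \<open>v\<close>.  Hence the eigenspaces are exactly the \<open>\<Lambda>\<^sub>k\<close>, and since
  integration is a linear condition, a code \<open>C\<close> integrates all of them except \<open>\<Lambda>\<^sub>k\<close> with
  \<open>k = 2\<^sup>r\<^sup>-\<^sup>1\<close> iff \<open>\<chi>\<^sub>v\<close> sums to zero over \<open>C\<close> for all \<open>v \<noteq> 0\<close> of weight other than \<open>k\<close>
  (\<open>integrates_other_cube_eigenspaces_iff\<close>).

  The size bound is a linear programming argument in the style of Delsarte.  Let \<open>B\<close> consist of
  \<open>0\<close> and the unit vectors.  Summed over \<open>B\<close>, the character \<open>\<chi>\<^sub>v\<close> gives \<open>n + 1 - 2 |v|\<close>, which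
  vanishes exactly at the exceptional weight \<open>k = (n + 1) / 2\<close>.  So in the sum over \<open>v\<close> of
  (sum of \<open>\<chi>\<^sub>v\<close> over \<open>B\<close>) times (sum of \<open>\<chi>\<^sub>v\<close> over \<open>C\<close>) only \<open>v = 0\<close> contributes, with
  \<open>(n + 1) |C|\<close>; by orthogonality the same sum is \<open>2\<^sup>n |C \<inter> B|\<close>
  (\<open>card_code_times_ball\<close>).  A linear code contains \<open>0\<close>, so \<open>|C \<inter> B| \<ge> 1\<close>, and equality
  holds for the Hamming code, because the columns of its parity-check matrix are nonzero.

  It remains to locate the words \<open>v\<close> orthogonal to the Hamming code.  The code contains the sum of
  the unit vectors at the columns \<open>a\<close>, \<open>b\<close> and \<open>a + b\<close>, so such a \<open>v\<close>, read as a function of the columns, is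
  additive (\<open>hamming_dual_weight\<close>).  A nonzero additive functional is \<open>1\<close> on exactly half
  of the \<open>2\<^sup>r\<close> vectors, so \<open>v\<close> has weight \<open>k\<close>; and the rows of the matrix are such words, so
  \<open>\<Lambda>\<^sub>k\<close> itself is not integrated (\<open>hamming_dual_word\<close>).
\<close>

section \<open>Characters of the cube\<close>

abbreviation weight :: "bit ^ 'd::finite \<Rightarrow> nat" where
  "weight v \<equiv> card {i. v $ i = 1}"

abbreviation unit :: "'d::finite \<Rightarrow> bit ^ 'd" where
  "unit i \<equiv> axis i 1"

text \<open>
  Left as simplification rules, these two equations would replace addition and multiplication by bit
  operations, for which the ring and vector lemmas do not apply.
\<close>

declare add_bit_eq_xor [simp del] mult_bit_eq_and [simp del]

lemma bit_add_self [simp]: "b + b = (0 :: bit)"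
  by (cases b) simp_all

lemma bit_add_eq_0_iff: "b + c = 0 \<longleftrightarrow> b = (c :: bit)"
  by (cases b; cases c) simp_all

lemma bit_vec_add_self [simp]: "x + x = (0 :: bit ^ 'd::finite)"
  by (simp add: vec_eq_iff)

lemma bit_vec_add_eq_0_iff: "x + y = 0 \<longleftrightarrow> x = (y :: bit ^ 'd::finite)"
  by (simp add: vec_eq_iff bit_add_eq_0_iff)

text \<open>
  Written as a product over the coordinates, the sign is visibly multiplicative in either argument.
\<close>

lemma cube_character_prod:
  "cube_character v $ x = (\<Prod>i\<in>UNIV. if v $ i = 1 \<and> x $ i = 1 then -1 else 1)"
  by (simp add: cube_character_def prod.If_cases)

lemma cube_character_commute: "cube_character v $ x = cube_character x $ v"
  by (simp add: cube_character_def conj_commute)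

lemma cube_character_add:
  "cube_character v $ (x + y) = cube_character v $ x * cube_character v $ y"
  unfolding cube_character_prod prod.distrib[symmetric]
  by (rule prod.cong) auto

lemma cube_character_zero [simp]: "cube_character v $ 0 = 1"
  by (simp add: cube_character_def)

lemma cube_character_zero_left [simp]: "cube_character 0 $ x = 1"
  by (simp add: cube_character_def)

lemma cube_character_cases: "cube_character v $ x = 1 \<or> cube_character v $ x = -1"
  by (cases "even (card {i. v $ i = 1 \<and> x $ i = 1})") (simp_all add: cube_character_def)

lemma cube_character_unit:
  "cube_character v $ unit i = (if v $ i = 1 then -1 else 1)"
proof -
  have "{j. v $ j = 1 \<and> unit i $ j = 1} = (if v $ i = 1 then {i} else {})"
    by (auto simp: axis_def)
  then show ?thesis by (simp add: cube_character_def)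
qed

lemma sum_cube_character_unit:
  "(\<Sum>i\<in>UNIV. cube_character v $ unit i) = real CARD('d) - 2 * real (weight v)"
  for v :: "bit ^ 'd::finite"
proof -
  have "(\<Sum>i\<in>UNIV. cube_character v $ unit i) = (\<Sum>i\<in>UNIV. 1 - 2 * of_bool (v $ i = 1))"
    by (rule sum.cong) (auto simp: cube_character_unit)
  also have "\<dots> = real CARD('d) - 2 * real (weight v)"
    by (simp add: sum_subtractf flip: sum_distrib_left)
  finally show ?thesis .
qed

lemma sum_translate:
  fixes h :: "bit ^ 'd::finite"
  assumes "\<And>x. x \<in> C \<Longrightarrow> x + h \<in> C"
  shows "(\<Sum>x\<in>C. f (x + h)) = (\<Sum>x\<in>C. f x)"
  by (rule sum.reindex_bij_witness[where i = "\<lambda>x. x + h" and j = "\<lambda>x. x + h"])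
    (auto simp: assms add.assoc)

text \<open>
  Translation by \<open>h\<close> permutes \<open>C\<close> and reverses the sign of every summand.
\<close>

lemma sum_cube_character_eq_0:
  fixes h :: "bit ^ 'd::finite"
  assumes "\<And>x. x \<in> C \<Longrightarrow> x + h \<in> C" and "cube_character v $ h = -1"
  shows "(\<Sum>x\<in>C. cube_character v $ x) = 0"
  using sum_translate[of C h "\<lambda>x. cube_character v $ x"] assms
  by (simp add: cube_character_add sum_negf)

lemma sum_all_cube_character:
  fixes v :: "bit ^ 'd::finite"
  shows "(\<Sum>x\<in>UNIV. cube_character v $ x) = (if v = 0 then real CARD(bit ^ 'd) else 0)"
proof (cases "v = 0")
  case False
  then obtain i where "v $ i = 1"
    by (auto simp: vec_eq_iff)
  then have "cube_character v $ unit i = -1"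
    by (simp add: cube_character_unit)
  with False show ?thesis
    using sum_cube_character_eq_0[of UNIV "unit i" v] by simp
qed simp

lemma cube_character_orthogonality:
  fixes x y :: "bit ^ 'd::finite"
  shows "(\<Sum>v\<in>UNIV. cube_character v $ x * cube_character v $ y) =
    (if x = y then real CARD(bit ^ 'd) else 0)"
proof -
  have "(\<Sum>v\<in>UNIV. cube_character v $ x * cube_character v $ y) =
      (\<Sum>v\<in>UNIV. cube_character (x + y) $ v)"
    by (metis (no_types) cube_character_add cube_character_commute)
  then show ?thesis
    by (simp add: sum_all_cube_character bit_vec_add_eq_0_iff)
qed

text \<open>
  Column orthogonality of the character table says that the characters form an orthogonal basis.
  The constant is the inverse of their common squared norm.
\<close>

lemma fourier_inversion:
  fixes \<phi> :: "real ^ (bit ^ 'd::finite)"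
  shows "\<phi> = (1 / real CARD(bit ^ 'd)) *\<^sub>R (\<Sum>v\<in>UNIV. (\<phi> \<bullet> cube_character v) *\<^sub>R cube_character v)"
proof -
  have "(\<Sum>v\<in>UNIV. (\<phi> \<bullet> cube_character v) * cube_character v $ x) = real CARD(bit ^ 'd) * \<phi> $ x"
    for x
  proof -
    have "(\<Sum>v\<in>UNIV. (\<phi> \<bullet> cube_character v) * cube_character v $ x)
        = (\<Sum>v\<in>UNIV. \<Sum>y\<in>UNIV. \<phi> $ y * (cube_character v $ y * cube_character v $ x))"
      by (simp add: inner_vec_def sum_distrib_right mult.assoc)
    also have "\<dots> = (\<Sum>y\<in>UNIV. \<Sum>v\<in>UNIV. \<phi> $ y * (cube_character v $ y * cube_character v $ x))"
      by (rule sum.swap)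
    also have "\<dots> = (\<Sum>y\<in>UNIV. \<phi> $ y * (if y = x then real CARD(bit ^ 'd) else 0))"
      by (simp only: sum_distrib_left[symmetric] cube_character_orthogonality)
    also have "\<dots> = real CARD(bit ^ 'd) * \<phi> $ x"
      by (simp add: if_distrib cong: if_cong)
    finally show ?thesis .
  qed
  then show ?thesis
    by (simp add: vec_eq_iff)
qed

section \<open>The eigenspaces of the cube\<close>

lemma cube_neighbours: "{y. cube x y} = range (\<lambda>i. x + unit i)"
proof (intro set_eqI iffI)
  fix y assume "y \<in> {y. cube x y}"
  then obtain i where i: "{j. x $ j \<noteq> y $ j} = {i}"
    by (auto simp: cube_def card_1_singleton_iff)
  have "y $ j = x $ j + unit i $ j" for j
  proof (cases "j = i")
    case True
    then have "x $ j \<noteq> y $ j" using i by blast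
    then show ?thesis using True by (cases "x $ j"; cases "y $ j") (simp_all add: axis_def)
  next
    case False
    then have "x $ j = y $ j" using i by blast
    then show ?thesis using False by (simp add: axis_def)
  qed
  then have "y = x + unit i"
    by (simp add: vec_eq_iff)
  then show "y \<in> range (\<lambda>i. x + unit i)"
    by blast
next
  fix y assume "y \<in> range (\<lambda>i. x + unit i)"
  then obtain i where y: "y = x + unit i" by blast
  have "{j. x $ j \<noteq> y $ j} = {i}"
    by (auto simp: y axis_def)
  then show "y \<in> {y. cube x y}"
    by (simp add: cube_def)
qed

lemma inj_add_unit: "inj (\<lambda>i. x + unit i)"
  by (auto simp: inj_def axis_eq_axis)

lemma cube_degree_matrix:
  "degree_matrix (cube :: (bit ^ 'd::finite) graph) = mat (real CARD('d))"
  by (auto simp: degree_matrix_def mat_def vec_eq_iff cube_neighbours card_image inj_add_unit)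

lemma matrix_inv_mat:
  fixes a :: real
  assumes "a \<noteq> 0"
  shows "matrix_inv (mat a :: real ^ 'n ^ 'n) = mat (1 / a)"
proof -
  have mult: "mat b ** (mat c :: real ^ 'n ^ 'n) = mat (b * c)" for b c
    by (auto simp: matrix_matrix_mult_def mat_def vec_eq_iff mult_delta_left)
  let ?N = "matrix_inv (mat a :: real ^ 'n ^ 'n)"
  have "(mat a :: real ^ 'n ^ 'n) ** mat (1 / a) = mat 1 \<and> mat (1 / a) ** (mat a :: real ^ 'n ^ 'n) = mat 1"
    using assms by (simp add: mult)
  then have "?N ** mat a = mat 1"
    unfolding matrix_inv_def by (rule someI2) blast
  then have "?N ** (mat a ** mat (1 / a)) = mat 1 ** mat (1 / a)"
    by (metis matrix_mul_assoc)
  with assms show ?thesis by (simp add: mult)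
qed

lemma cube_laplacian_nth:
  fixes \<phi> :: "real ^ (bit ^ 'd::finite)"
  shows "(laplacian cube *v \<phi>) $ x = (\<Sum>i\<in>UNIV. \<phi> $ (x + unit i)) / real CARD('d) - \<phi> $ x"
proof -
  have "(adjacency_matrix cube *v (mat (1 / real CARD('d)) *v \<phi>)) $ x
      = (\<Sum>y | cube x y. \<phi> $ y) / real CARD('d)"
    unfolding sum_divide_distrib
    by (simp add: matrix_vector_mult_def adjacency_matrix_def mat_def mult_delta_left)
      (rule sum.mono_neutral_cong_right, auto)
  also have "(\<Sum>y | cube x y. \<phi> $ y) = (\<Sum>i\<in>UNIV. \<phi> $ (x + unit i))"
    unfolding cube_neighbours by (simp add: sum.reindex inj_add_unit)
  finally show ?thesis
    by (simp add: laplacian_def cube_degree_matrix matrix_inv_mat matrix_vector_mult_diff_rdistrib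
        matrix_vector_mul_assoc)
qed

definition cube_eigenvalue :: "'d::finite itself \<Rightarrow> nat \<Rightarrow> real" where
  "cube_eigenvalue _ k = - 2 * real k / real CARD('d)"

lemma laplacian_cube_character:
  fixes v :: "bit ^ 'd::finite"
  shows "laplacian cube *v cube_character v
    = cube_eigenvalue TYPE('d) (weight v) *s cube_character v"
  by (simp add: vec_eq_iff cube_laplacian_nth cube_character_add cube_eigenvalue_def
      sum_cube_character_unit flip: sum_distrib_left) (simp add: field_simps)

text \<open>
  The Laplacian averages over translations by unit vectors.  Translating a function multiplies its
  coefficient at \<open>v\<close> by a value of the character, so the Laplacian acts diagonally on coefficients.
\<close>

lemma laplacian_inner_cube_character:
  fixes \<phi> :: "real ^ (bit ^ 'd::finite)"
  shows "(laplacian cube *v \<phi>) \<bullet> cube_character v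
    = cube_eigenvalue TYPE('d) (weight v) * (\<phi> \<bullet> cube_character v)"
proof -
  have shift: "(\<Sum>x\<in>UNIV. \<phi> $ (x + unit i) * cube_character v $ x)
      = cube_character v $ unit i * (\<phi> \<bullet> cube_character v)" for i
  proof -
    have "(\<Sum>x\<in>UNIV. \<phi> $ (x + unit i) * cube_character v $ x)
        = (\<Sum>x\<in>UNIV. \<phi> $ (x + unit i + unit i) * cube_character v $ (x + unit i))"
      by (rule sum_translate[symmetric]) simp
    also have "\<dots> = (\<Sum>x\<in>UNIV. cube_character v $ unit i * (\<phi> $ x * cube_character v $ x))"
      by (rule sum.cong) (simp_all add: add.assoc cube_character_add)
    finally show ?thesis
      by (simp add: inner_vec_def sum_distrib_left)
  qed
  have "(laplacian cube *v \<phi>) \<bullet> cube_character v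
      = (\<Sum>x\<in>UNIV. \<Sum>i\<in>UNIV. \<phi> $ (x + unit i) * cube_character v $ x) / real CARD('d)
        - \<phi> \<bullet> cube_character v"
    by (simp add: inner_vec_def cube_laplacian_nth left_diff_distrib sum_subtractf
        sum_divide_distrib sum_distrib_right)
  also have "(\<Sum>x\<in>UNIV. \<Sum>i\<in>UNIV. \<phi> $ (x + unit i) * cube_character v $ x)
      = (\<Sum>i\<in>UNIV. cube_character v $ unit i) * (\<phi> \<bullet> cube_character v)"
    by (subst sum.swap) (simp add: shift sum_distrib_right)
  finally show ?thesis
    by (simp add: sum_cube_character_unit cube_eigenvalue_def field_simps)
qed

lemma cube_eigenvalue_eq_iff [simp]:
  "cube_eigenvalue TYPE('d::finite) k = cube_eigenvalue TYPE('d) l \<longleftrightarrow> k = l"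
  by (simp add: cube_eigenvalue_def)

text \<open>
  Comparing coefficients, an eigenvector with eigenvalue \<open>\<mu>\<close> has no component along a character
  with another eigenvalue; Fourier inversion then puts it into the span of the remaining ones.
\<close>

lemma cube_eigenvectors:
  fixes \<mu> :: real
  shows "{\<phi> :: real ^ (bit ^ 'd::finite). laplacian cube *v \<phi> = \<mu> *s \<phi>}
    = span {cube_character v | v. cube_eigenvalue TYPE('d) (weight v) = \<mu>}"
    (is "?E = span ?B")
proof
  have "subspace ?E"
    by (auto simp: subspace_def matrix_vector_right_distrib vector_add_ldistrib
        scalar_mult_eq_scaleR matrix_vector_mult_scaleR scaleR_add_right scaleR_left_commute)
  moreover have "?B \<subseteq> ?E"
    by (auto simp: laplacian_cube_character)
  ultimately show "span ?B \<subseteq> ?E"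
    by (rule span_minimal[rotated])
next
  show "?E \<subseteq> span ?B"
  proof
    fix \<phi> :: "real ^ (bit ^ 'd)" assume "\<phi> \<in> ?E"
    then have "\<mu> * (\<phi> \<bullet> cube_character v)
        = cube_eigenvalue TYPE('d) (weight v) * (\<phi> \<bullet> cube_character v)" for v
      using laplacian_inner_cube_character[of \<phi> v] by (simp add: scalar_mult_eq_scaleR)
    then have coeff: "\<phi> \<bullet> cube_character v = 0 \<or> cube_eigenvalue TYPE('d) (weight v) = \<mu>" for v
      by (metis mult_cancel_right)
    have "(\<phi> \<bullet> cube_character v) *\<^sub>R cube_character v \<in> span ?B" for v
    proof (cases "\<phi> \<bullet> cube_character v = 0")
      case False
      with coeff have "cube_character v \<in> ?B" by blast
      then show ?thesis by (intro span_scale span_base)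
    qed (simp add: span_zero)
    then have "(1 / real CARD(bit ^ 'd)) *\<^sub>R
        (\<Sum>v\<in>UNIV. (\<phi> \<bullet> cube_character v) *\<^sub>R cube_character v) \<in> span ?B"
      by (rule span_scale[OF span_sum])
    then show "\<phi> \<in> span ?B"
      using fourier_inversion[of \<phi>] by simp
  qed
qed

lemma cube_Lambda_eq_eigenvectors:
  "cube_Lambda k = {\<phi> :: real ^ (bit ^ 'd::finite).
     laplacian cube *v \<phi> = cube_eigenvalue TYPE('d) k *s \<phi>}"
  by (simp add: cube_Lambda_def cube_eigenvectors)

lemma cube_character_in_cube_Lambda: "cube_character v \<in> cube_Lambda (weight v)"
  unfolding cube_Lambda_def by (rule span_base) blast

lemma cube_character_nonzero: "cube_character v \<noteq> 0"
  by (metis cube_character_zero zero_index zero_neq_one)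

lemma laplacian_eigenspace_cube_Lambda:
  fixes v :: "bit ^ 'd::finite"
  shows "laplacian_eigenspace cube (cube_Lambda (weight v) :: (real ^ (bit ^ 'd)) set)"
  unfolding laplacian_eigenspace_def
proof
  show "(cube_Lambda (weight v) :: (real ^ (bit ^ 'd)) set) \<noteq> {0}"
    using cube_character_in_cube_Lambda[of v] cube_character_nonzero[of v] by force
  show "\<exists>\<mu>. (cube_Lambda (weight v) :: (real ^ (bit ^ 'd)) set) = {\<phi>. laplacian cube *v \<phi> = \<mu> *s \<phi>}"
    by (rule exI) (rule cube_Lambda_eq_eigenvectors)
qed

text \<open>
  Since the eigenvalue is an injective function of the weight, distinct weights are never merged
  into one eigenspace.
\<close>

lemma laplacian_eigenspace_cube_cases:
  fixes E :: "(real ^ (bit ^ 'd::finite)) set"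
  assumes "laplacian_eigenspace cube E"
  obtains v :: "bit ^ 'd" where "E = cube_Lambda (weight v)"
proof -
  from assms obtain \<mu> where E: "E \<noteq> {0}" "E = {\<phi>. laplacian cube *v \<phi> = \<mu> *s \<phi>}"
    unfolding laplacian_eigenspace_def by auto
  have "\<exists>v :: bit ^ 'd. cube_eigenvalue TYPE('d) (weight v) = \<mu>"
  proof (rule ccontr)
    assume "\<not> ?thesis"
    then have "E = span {}"
      unfolding E(2) cube_eigenvectors by simp
    with E(1) show False by simp
  qed
  then obtain v :: "bit ^ 'd" where v: "cube_eigenvalue TYPE('d) (weight v) = \<mu>" ..
  have "E = cube_Lambda (weight v)"
    by (simp only: cube_Lambda_eq_eigenvectors v E(2))
  then show ?thesis by (rule that)
qed

text \<open>
  This is what distinguishes the spaces \<open>\<Lambda>\<^sub>k\<close> that occur from each other: a character is nonzero, so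
  it cannot have two eigenvalues.
\<close>

lemma cube_character_mem_cube_Lambda_iff:
  "cube_character v \<in> cube_Lambda k \<longleftrightarrow> weight v = k"
proof
  assume "cube_character v \<in> cube_Lambda k"
  then show "weight v = k"
    using cube_character_nonzero[of v]
    by (simp add: cube_Lambda_eq_eigenvectors laplacian_cube_character vector_mul_rcancel)
qed (auto simp: cube_character_in_cube_Lambda)

section \<open>Integration\<close>

lemma subspace_integrates:
  assumes "W \<noteq> {}"
  shows "subspace {\<phi>. integrates W \<phi>}"
  using assms
  by (auto simp: subspace_def integrates_def sum.distrib add_divide_distrib simp flip: sum_distrib_left
      times_divide_eq_right)

text \<open>
  The functions integrated by \<open>W\<close> form a subspace, so the choice of the basis is irrelevant.
\<close>

lemma integrates_eigenspace_iff:
  assumes "subspace E" and "W \<noteq> {}"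
  shows "integrates_eigenspace W E \<longleftrightarrow> (\<forall>\<phi>\<in>E. integrates W \<phi>)"
proof
  assume "integrates_eigenspace W E"
  then obtain B where B: "span B = E" "\<forall>\<phi>\<in>B. integrates W \<phi>"
    unfolding integrates_eigenspace_def by auto
  then have "span B \<subseteq> {\<phi>. integrates W \<phi>}"
    by (intro span_minimal subspace_integrates) (use assms in auto)
  with B show "\<forall>\<phi>\<in>E. integrates W \<phi>" by auto
next
  assume *: "\<forall>\<phi>\<in>E. integrates W \<phi>"
  obtain B where "B \<subseteq> E" "independent B" "E \<subseteq> span B"
    using maximal_independent_subset by blast
  with * assms show "integrates_eigenspace W E"
    unfolding integrates_eigenspace_def
    by (metis span_minimal subset_antisym subset_iff)
qed

text \<open>
  By linearity, the defining spanning set can be tested in place of a basis.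
\<close>

lemma integrates_cube_Lambda_iff:
  fixes W :: "(bit ^ 'd::finite) set"
  assumes "W \<noteq> {}"
  shows "integrates_eigenspace W (cube_Lambda k)
    \<longleftrightarrow> (\<forall>v. weight v = k \<longrightarrow> integrates W (cube_character v))"
proof -
  have "subspace (cube_Lambda k :: (real ^ (bit ^ 'd)) set)"
    by (simp add: cube_Lambda_def)
  then have "integrates_eigenspace W (cube_Lambda k) \<longleftrightarrow> cube_Lambda k \<subseteq> {\<phi>. integrates W \<phi>}"
    using integrates_eigenspace_iff[OF _ assms] by blast
  also have "\<dots> \<longleftrightarrow> {cube_character v | v. weight v = k} \<subseteq> {\<phi>. integrates W \<phi>}"
    unfolding cube_Lambda_def
    by (meson assms span_minimal span_superset subset_trans subspace_integrates)
  finally show ?thesis by blast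
qed

text \<open>
  A nontrivial character has mean zero on the whole cube, and the trivial one is constant.
\<close>

lemma integrates_cube_character_iff:
  assumes "W \<noteq> {}"
  shows "integrates W (cube_character v) \<longleftrightarrow> v = 0 \<or> (\<Sum>w\<in>W. cube_character v $ w) = 0"
  using assms by (auto simp: integrates_def sum_all_cube_character)

lemma integrates_other_cube_eigenspaces_iff:
  fixes W :: "(bit ^ 'd::finite) set" and \<Lambda> :: "(real ^ (bit ^ 'd)) set"
  assumes "W \<noteq> {}" and "\<Lambda> = cube_Lambda k"
  shows "(\<forall>E. laplacian_eigenspace cube E \<and> E \<noteq> \<Lambda> \<longrightarrow> integrates_eigenspace W E)
    \<longleftrightarrow> (\<forall>v. v \<noteq> 0 \<and> weight v \<noteq> k \<longrightarrow> (\<Sum>w\<in>W. cube_character v $ w) = 0)"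
    (is "?L \<longleftrightarrow> ?R")
proof
  assume L: ?L
  show ?R
  proof (intro allI impI)
    fix v :: "bit ^ 'd" assume v: "v \<noteq> 0 \<and> weight v \<noteq> k"
    then have "cube_Lambda (weight v) \<noteq> \<Lambda>"
      using assms(2) cube_character_mem_cube_Lambda_iff[of v] by blast
    then have "integrates W (cube_character v)"
      using L laplacian_eigenspace_cube_Lambda[of v] integrates_cube_Lambda_iff[OF assms(1)]
      by blast
    with v show "(\<Sum>w\<in>W. cube_character v $ w) = 0"
      using integrates_cube_character_iff[OF assms(1)] by blast
  qed
next
  assume R: ?R
  show ?L
  proof (intro allI impI, elim conjE)
    fix E :: "(real ^ (bit ^ 'd)) set"
    assume "laplacian_eigenspace cube E" and "E \<noteq> \<Lambda>"
    then obtain v :: "bit ^ 'd" where v: "E = cube_Lambda (weight v)" "weight v \<noteq> k"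
      using assms(2) laplacian_eigenspace_cube_cases[of E] by metis
    then show "integrates_eigenspace W E"
      using R by (auto simp: integrates_cube_Lambda_iff[OF assms(1)]
          integrates_cube_character_iff[OF assms(1)])
  qed
qed

section \<open>The size of codes whose dual words have weight half of the length\<close>

text \<open>
  The double sum of \<open>\<chi>\<^sub>v(b) \<chi>\<^sub>v(c)\<close> over \<open>b \<in> B\<close> and \<open>c \<in> C\<close>, summed over all \<open>v\<close>, is evaluated
  in two ways.  The set \<open>B\<close> is the Hamming ball of radius 1 around the origin; its transform is an
  affine function of the weight whose zero is the one weight that the hypothesis leaves open.
\<close>

lemma card_code_times_ball:
  fixes C :: "(bit ^ 'd::finite) set"
  assumes vanish: "\<And>v. v \<noteq> 0 \<Longrightarrow> 2 * weight v \<noteq> CARD('d) + 1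
    \<Longrightarrow> (\<Sum>c\<in>C. cube_character v $ c) = 0"
  shows "(CARD('d) + 1) * card C = CARD(bit ^ 'd) * card (C \<inter> insert 0 (range unit))"
proof -
  let ?B = "insert 0 (range unit) :: (bit ^ 'd) set"
  have ball: "(\<Sum>b\<in>?B. cube_character v $ b) = real CARD('d) + 1 - 2 * real (weight v)" for v
  proof -
    have "0 \<notin> (range unit :: (bit ^ 'd) set)"
      by (auto simp: axis_eq_0_iff eq_commute[of 0])
    moreover have "inj (unit :: 'd \<Rightarrow> bit ^ 'd)"
      by (auto simp: inj_def axis_eq_axis)
    ultimately show ?thesis
      by (simp add: sum.reindex sum_cube_character_unit)
  qed
  have "(\<Sum>v\<in>UNIV. (\<Sum>b\<in>?B. cube_character v $ b) * (\<Sum>c\<in>C. cube_character v $ c))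
      = (\<Sum>v\<in>UNIV. if v = (0 :: bit ^ 'd) then (real CARD('d) + 1) * real (card C) else 0)"
  proof (rule sum.cong[OF refl])
    fix v :: "bit ^ 'd"
    show "(\<Sum>b\<in>?B. cube_character v $ b) * (\<Sum>c\<in>C. cube_character v $ c)
      = (if v = 0 then (real CARD('d) + 1) * real (card C) else 0)"
    proof (cases "v = 0")
      case True then show ?thesis unfolding ball by simp
    next
      case False
      show ?thesis
      proof (cases "2 * weight v = CARD('d) + 1")
        case True
        then have "2 * real (weight v) = real CARD('d) + 1"
          by (metis of_nat_1 of_nat_add of_nat_mult of_nat_numeral)
        with False show ?thesis unfolding ball by simp
      qed (use False vanish in simp)
    qed
  qed
  also have "\<dots> = (real CARD('d) + 1) * real (card C)"
    by simp
  finally have lhs: "(\<Sum>v\<in>UNIV. (\<Sum>b\<in>?B. cube_character v $ b) * (\<Sum>c\<in>C. cube_character v $ c))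
    = (real CARD('d) + 1) * real (card C)" .
  have "(\<Sum>v\<in>UNIV. (\<Sum>b\<in>?B. cube_character v $ b) * (\<Sum>c\<in>C. cube_character v $ c))
      = (\<Sum>v\<in>UNIV. \<Sum>c\<in>C. \<Sum>b\<in>?B. cube_character v $ b * cube_character v $ c)"
    by (subst sum.swap) (simp only: sum_product)
  also have "\<dots> = (\<Sum>c\<in>C. \<Sum>b\<in>?B. \<Sum>v\<in>UNIV. cube_character v $ b * cube_character v $ c)"
    by (subst sum.swap, rule sum.cong[OF refl], rule sum.swap)
  also have "\<dots> = (\<Sum>c\<in>C. if c \<in> ?B then real CARD(bit ^ 'd) else 0)"
    by (simp only: cube_character_orthogonality sum.delta' finite finite_insert finite_imageI sum.delta)
  also have "\<dots> = real CARD(bit ^ 'd) * real (card (C \<inter> ?B))"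
    by (simp only: sum.inter_restrict[OF finite, symmetric]) simp
  finally have rhs: "(\<Sum>v\<in>UNIV. (\<Sum>b\<in>?B. cube_character v $ b) * (\<Sum>c\<in>C. cube_character v $ c))
    = real CARD(bit ^ 'd) * real (card (C \<inter> ?B))" .
  have "real ((CARD('d) + 1) * card C) = real (CARD(bit ^ 'd) * card (C \<inter> ?B))"
    using trans[OF lhs[symmetric] rhs] by (simp only: of_nat_mult of_nat_add of_nat_1)
  then show ?thesis
    by (simp only: of_nat_eq_iff)
qed

section \<open>Hamming codes\<close>

text \<open>
  Adding \<open>a\<close> exchanges the two fibres of \<open>f\<close>.
\<close>

lemma card_fibre_additive:
  fixes f :: "bit ^ 'r::finite \<Rightarrow> bit"
  assumes add: "\<And>u w. f (u + w) = f u + f w" and "f a = 1"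
  shows "2 * card {u. f u = 1} = CARD(bit ^ 'r)"
proof -
  have "bij_betw (\<lambda>u. u + a) {u. f u = 1} {u. f u = 0}"
    by (rule bij_betw_byWitness[where f' = "\<lambda>u. u + a"])
      (auto simp: assms(2) add.assoc add)
  then have "card {u. f u = 1} = card {u. f u = 0}"
    by (rule bij_betw_same_card)
  moreover have "{u. f u = 1} \<union> {u. f u = 0} = UNIV"
    using bit.exhaust by blast
  moreover have "card ({u. f u = 1} \<union> {u. f u = 0}) = card {u. f u = 1} + card {u. f u = 0}"
    by (rule card_Un_disjoint) auto
  ultimately show ?thesis by (metis mult_2)
qed

lemma hamming_matrix_card:
  fixes M :: "bit ^ 'd::finite ^ 'r::finite"
  assumes "hamming_matrix M"
  shows "CARD(bit ^ 'r) = CARD('d) + 1"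
proof -
  have "CARD(bit ^ 'r) = card (insert 0 {u :: bit ^ 'r. u \<noteq> 0})"
    by (rule arg_cong[where f = card]) auto
  also have "\<dots> = Suc (card {u :: bit ^ 'r. u \<noteq> 0})"
    by (rule card_insert_disjoint) auto
  also have "card {u :: bit ^ 'r. u \<noteq> 0} = CARD('d)"
    using assms unfolding hamming_matrix_def by (rule bij_betw_same_card[symmetric])
  finally show ?thesis
    by (simp only: Suc_eq_plus1)
qed

lemma matrix_vector_mult_unit: "M *v unit j = column j M"
  for M :: "bit ^ 'd::finite ^ 'r::finite"
  by (auto simp: vec_eq_iff matrix_vector_mult_def axis_def column_def mult_delta_right)

text \<open>
  As the columns run through all nonzero vectors and \<open>f\<close> vanishes at the zero vector, the ones of
  \<open>v\<close> correspond to the fibre of \<open>f\<close> over \<open>1\<close>, which is half of the space.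
\<close>

lemma weight_additive_on_columns:
  fixes M :: "bit ^ 'd::finite ^ 'r::finite" and v :: "bit ^ 'd"
  assumes M: "hamming_matrix M" and add: "\<And>u w. f (u + w) = f u + f w"
    and v: "\<And>j. f (column j M) = v $ j" and "v \<noteq> 0"
  shows "2 * weight v = CARD('d) + 1"
proof -
  have f0: "f 0 = 0"
    using add[of 0 0] by simp
  obtain i where "v $ i = 1"
    using \<open>v \<noteq> 0\<close> by (auto simp: vec_eq_iff)
  then have "f (column i M) = 1"
    by (simp add: v)
  then have "2 * card {u. f u = 1} = CARD('d) + 1"
    using card_fibre_additive[of f, OF add] by (simp only: hamming_matrix_card[OF M])
  moreover have bij: "bij_betw (\<lambda>j. column j M) {j. v $ j = 1} {u. f u = 1}"
    using M unfolding hamming_matrix_def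
  proof (rule bij_betw_subset)
    show "(\<lambda>j. column j M) ` {j. v $ j = 1} = {u. f u = 1}"
    proof
      show "{u. f u = 1} \<subseteq> (\<lambda>j. column j M) ` {j. v $ j = 1}"
      proof
        fix u assume u: "u \<in> {u. f u = 1}"
        then have "u \<in> {u. u \<noteq> 0}" using f0 by auto
        then obtain j where "u = column j M"
          using M unfolding hamming_matrix_def bij_betw_def by blast
        with u v show "u \<in> (\<lambda>j. column j M) ` {j. v $ j = 1}" by auto
      qed
    qed (use v in auto)
  qed auto
  ultimately show ?thesis
    by (simp add: bij_betw_same_card[OF bij])
qed

lemma subspace_hamming_code: "vec.subspace (hamming_code M)"
  by (auto simp: vec.subspace_def hamming_code_def matrix_vector_right_distrib vector_scalar_commute)

text \<open>
  A word orthogonal to the Hamming code belongs to the simplex code, all of whose nonzero words have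
  the same weight.  The functional of which the word is the table of values is constructed directly.
\<close>

lemma hamming_dual_weight:
  fixes M :: "bit ^ 'd::finite ^ 'r::finite" and v :: "bit ^ 'd"
  assumes M: "hamming_matrix M" and dual: "\<And>h. h \<in> hamming_code M \<Longrightarrow> cube_character v $ h = 1"
    and "v \<noteq> 0"
  shows "2 * weight v = CARD('d) + 1"
proof -
  define idx where "idx = inv (\<lambda>j. column j M)"
  have idx: "column (idx u) M = u" if "u \<noteq> 0" for u
    unfolding idx_def using M that
    by (intro f_inv_into_f) (auto simp: hamming_matrix_def bij_betw_def)
  have idx_column: "idx (column j M) = j" for j
    unfolding idx_def using M by (intro inv_f_f) (auto simp: hamming_matrix_def bij_betw_def)
  have column_nonzero: "column j M \<noteq> 0" for j
    using M by (auto simp: hamming_matrix_def bij_betw_def)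
  define f where "f u = (if u = 0 then 0 else v $ idx u)" for u
  have "f (u + w) = f u + f w" for u w
  proof (cases "u = 0 \<or> w = 0 \<or> u = w")
    case True
    then show ?thesis by (auto simp: f_def)
  next
    case False
    then have "u + w \<noteq> 0" by (simp add: bit_vec_add_eq_0_iff)
    \<comment> \<open>The columns \<open>u\<close>, \<open>w\<close> and \<open>u + w\<close> sum to zero, which gives a codeword of weight 3.\<close>
    let ?h = "unit (idx u) + unit (idx w) + unit (idx (u + w))"
    have "M *v ?h = u + w + (u + w)"
      using False \<open>u + w \<noteq> 0\<close>
      by (simp add: matrix_vector_right_distrib matrix_vector_mult_unit idx)
    then have "?h \<in> hamming_code M"
      by (simp only: bit_vec_add_self hamming_code_def mem_Collect_eq)
    from dual[OF this] False \<open>u + w \<noteq> 0\<close> show ?thesis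
      by (auto simp: cube_character_add cube_character_unit f_def bit_not_one_iff split: if_splits)
  qed
  moreover have "f (column j M) = v $ j" for j
    by (simp add: f_def column_nonzero idx_column)
  ultimately show ?thesis
    using weight_additive_on_columns M \<open>v \<noteq> 0\<close> by blast
qed

lemma sum_cube_character_hamming_code:
  fixes M :: "bit ^ 'd::finite ^ 'r::finite"
  assumes "hamming_matrix M" "v \<noteq> 0" "2 * weight v \<noteq> CARD('d) + 1"
  shows "(\<Sum>c\<in>hamming_code M. cube_character v $ c) = 0"
proof -
  obtain h where "h \<in> hamming_code M" "cube_character v $ h = -1"
    using hamming_dual_weight[of M v] assms cube_character_cases by metis
  then show ?thesis
    using sum_cube_character_eq_0[of "hamming_code M" h v] subspace_hamming_code[of M]
    by (auto intro: vec.subspace_add)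
qed

lemma unit_notin_hamming_code:
  assumes "hamming_matrix M"
  shows "unit j \<notin> hamming_code M"
  using assms by (auto simp: hamming_code_def matrix_vector_mult_unit hamming_matrix_def bij_betw_def)

text \<open>
  Any row of the parity-check matrix serves: it tabulates a coordinate functional on the columns, and it is
  orthogonal to the code by definition.
\<close>

lemma hamming_dual_word:
  fixes M :: "bit ^ 'd::finite ^ 'r::finite"
  assumes M: "hamming_matrix M"
  obtains v :: "bit ^ 'd" where "2 * weight v = CARD('d) + 1"
    "(\<Sum>c\<in>hamming_code M. cube_character v $ c) \<noteq> 0"
proof
  \<comment> \<open>Every row has the required property, so any index will do.\<close>
  let ?i = "undefined :: 'r"
  let ?v = "row ?i M"
  have "unit ?i \<in> range (\<lambda>j. column j M)"
    using M by (simp add: hamming_matrix_def bij_betw_def axis_eq_0_iff)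
  then obtain j where "unit ?i = column j M" by blast
  then have "?v $ j = 1"
    by (metis axis_nth column_def row_def vec_lambda_beta)
  then have "?v \<noteq> 0" by auto
  then show "2 * weight ?v = CARD('d) + 1"
    by (intro weight_additive_on_columns[OF M, where f = "\<lambda>u. u $ ?i"])
      (auto simp: column_def row_def)
  have "cube_character ?v $ c = 1" if "c \<in> hamming_code M" for c
  proof -
    let ?S = "{j. ?v $ j = 1 \<and> c $ j = 1}"
    have "0 = (M *v c) $ ?i"
      using that by (simp add: hamming_code_def)
    also have "\<dots> = (\<Sum>j\<in>UNIV. M $ ?i $ j * c $ j)"
      by (simp add: matrix_vector_mult_def)
    also have "\<dots> = (\<Sum>j\<in>UNIV. of_bool (j \<in> ?S))"
    proof (rule sum.cong[OF refl])
      fix j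
      show "M $ ?i $ j * c $ j = of_bool (j \<in> ?S)"
        by (cases "M $ ?i $ j"; cases "c $ j") (simp_all add: row_def)
    qed
    also have "\<dots> = of_nat (card ?S)"
      by simp
    finally have "even (of_nat (card ?S) :: bit)"
      by simp
    then have "even (card ?S)"
      by (simp only: even_of_nat_iff)
    then show ?thesis
      by (simp add: cube_character_def)
  qed
  then have "(\<Sum>c\<in>hamming_code M. cube_character ?v $ c) = real (card (hamming_code M))"
    by simp
  moreover have "hamming_code M \<noteq> {}"
    using vec.subspace_0[OF subspace_hamming_code] by blast
  ultimately show "(\<Sum>c\<in>hamming_code M. cube_character ?v $ c) \<noteq> 0"
    by simp
qed

theorem theorem4p10:
  fixes r :: nat and M :: "bit ^ 'd::finite ^ 'r::finite"
    and \<Lambda> :: "(real ^ (bit ^ 'd)) set"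
  assumes "r \<ge> 2"
    and "CARD('r) = r"
    and "CARD('d) = 2 ^ r - 1"
    and "hamming_matrix M"
    and "\<Lambda> = cube_Lambda (2 ^ (r - 1))"
  shows "laplacian_eigenspace cube \<Lambda>
    \<and> vec.subspace (hamming_code M)
    \<and> (\<forall>E. laplacian_eigenspace cube E \<and> E \<noteq> \<Lambda> \<longrightarrow> integrates_eigenspace (hamming_code M) E)
    \<and> \<not> integrates_eigenspace (hamming_code M) \<Lambda>
    \<and> (\<forall>C. vec.subspace C
           \<and> (\<forall>E. laplacian_eigenspace cube E \<and> E \<noteq> \<Lambda> \<longrightarrow> integrates_eigenspace C E)
         \<longrightarrow> card (hamming_code M) \<le> card C)"
proof -
  let ?H = "hamming_code M" and ?k = "2 ^ (r - 1) :: nat"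
  have "2 * ?k = 2 ^ r"
    using \<open>r \<ge> 2\<close> by (simp flip: power_Suc)
  then have weight: "2 * weight v = CARD('d) + 1 \<longleftrightarrow> weight v = ?k" for v :: "bit ^ 'd"
    using \<open>CARD('d) = 2 ^ r - 1\<close> by (metis Suc_eq_plus1 Suc_pred mult_cancel_left
        pos2 zero_less_power zero_neq_numeral diff_Suc_1 One_nat_def)
  have nonempty: "C \<noteq> {}" if "vec.subspace C" for C :: "(bit ^ 'd) set"
    using vec.subspace_0[OF that] by blast
  have H: "(\<Sum>c\<in>?H. cube_character v $ c) = 0" if "v \<noteq> 0" "weight v \<noteq> ?k" for v
    using sum_cube_character_hamming_code[OF \<open>hamming_matrix M\<close>] that weight by blast
  obtain v :: "bit ^ 'd" where v: "weight v = ?k" "(\<Sum>c\<in>?H. cube_character v $ c) \<noteq> 0"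
    using hamming_dual_word[OF \<open>hamming_matrix M\<close>] weight by metis
  have "v \<noteq> 0"
    using v(1) by (intro notI) simp
  have not: "\<not> integrates_eigenspace ?H \<Lambda>"
    using v \<open>v \<noteq> 0\<close> nonempty[OF subspace_hamming_code, of M] \<open>\<Lambda> = _\<close>
    by (auto simp: integrates_cube_Lambda_iff integrates_cube_character_iff)
  have min: "card ?H \<le> card C"
    if "vec.subspace C"
      and "\<forall>E. laplacian_eigenspace cube E \<and> E \<noteq> \<Lambda> \<longrightarrow> integrates_eigenspace C E" for C
  proof -
    let ?B = "insert 0 (range unit) :: (bit ^ 'd) set"
    have "(CARD('d) + 1) * card ?H = CARD(bit ^ 'd) * card (?H \<inter> ?B)"
      using card_code_times_ball[of ?H] H weight by blast
    also have "?H \<inter> ?B = {0}"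
      using vec.subspace_0[OF subspace_hamming_code, of M]
        unit_notin_hamming_code[OF \<open>hamming_matrix M\<close>] by auto
    also have "CARD(bit ^ 'd) * card {0 :: bit ^ 'd} \<le> CARD(bit ^ 'd) * card (C \<inter> ?B)"
      using vec.subspace_0[OF that(1)] by (intro mult_left_mono card_mono) auto
    also have "\<dots> = (CARD('d) + 1) * card C"
      using card_code_times_ball[of C] weight that(2)
        integrates_other_cube_eigenspaces_iff[OF nonempty[OF that(1)] \<open>\<Lambda> = _\<close>] by metis
    finally show ?thesis
      by (simp only: mult_le_cancel1)
  qed
  show ?thesis
    using laplacian_eigenspace_cube_Lambda[of v] v(1) \<open>\<Lambda> = _\<close> subspace_hamming_code[of M] not min H
      integrates_other_cube_eigenspaces_iff[OF nonempty[OF subspace_hamming_code, of M] \<open>\<Lambda> = _\<close>]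
    by auto
qed

end
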